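(* Let $g:\{0,1\}^N\to\{0,1\}$ be a Boolean function with $s_0(g)=1$ and $bs_0(g)=k$. Then $s_1(g)\ge \frac{3(k-1)}{2}$.
   Context: For $g:\{0,1\}^N\to\{0,1\}$ and $x\in\{0,1\}^N$, $x^{(i)}$ denotes $x$ with its $i$-th bit flipped, and $x^{(B)}$ denotes $x$ with all bits indexed by $B\subseteq[N]$ flipped. The sensitivity at $x$ is $s(g,x)=|\{i: g(x^{(i)})\neq g(x)\}|$; $s_0(g)=\max_{x\in g^{-1}(0)}s(g,x)$ and $s_1(g)=\max_{x\in g^{-1}(1)}s(g,x)$. The block sensitivity $bs(g,x)$ is the maximum number $b$ of pairwise disjoint subsets $B_1,\dots,B_b\subseteq[N]$ with $g(x^{(B_i)})\neq g(x)$ for all $i$; $bs_0(g)=\max_{x\in g^{-1}(0)}bs(g,x)$. *)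

theory Defs
  imports Complex_Main "HOL-Library.FuncSet" "HOL-Library.Disjoint_Sets"
begin

text \<open>
  The cube \<open>{0,1}\<^sup>N\<close> consists of the extensional functions on \<open>{1..N}\<close>, with
  \<open>False\<close> for 0 and \<open>True\<close> for 1. A Boolean function is a total function \<open>g\<close>
  on \<open>nat \<Rightarrow> bool\<close>, of which only the values on the cube are ever used.
\<close>

definition cube :: "nat \<Rightarrow> (nat \<Rightarrow> bool) set" where
  "cube N = {1..N} \<rightarrow>\<^sub>E UNIV"

definition flip_bits :: "(nat \<Rightarrow> bool) \<Rightarrow> nat set \<Rightarrow> nat \<Rightarrow> bool" where
  "flip_bits x B = (\<lambda>i. if i \<in> B then \<not> x i else x i)"

definition sens_at :: "nat \<Rightarrow> ((nat \<Rightarrow> bool) \<Rightarrow> bool) \<Rightarrow> (nat \<Rightarrow> bool) \<Rightarrow> nat" where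
  "sens_at N g x = card {i \<in> {1..N}. g (flip_bits x {i}) \<noteq> g x}"

text \<open>
  A block whose flip changes the value of \<open>g\<close> is nonempty, so pairwise disjoint such
  blocks are distinct, and counting the members of a set of blocks is the same as
  counting the terms of a sequence of blocks.
\<close>

definition block_sens_at :: "nat \<Rightarrow> ((nat \<Rightarrow> bool) \<Rightarrow> bool) \<Rightarrow> (nat \<Rightarrow> bool) \<Rightarrow> nat" where
  "block_sens_at N g x =
     Max {card F | F. F \<subseteq> Pow {1..N} \<and> disjoint F \<and> (\<forall>B\<in>F. g (flip_bits x B) \<noteq> g x)}"

text \<open>
  On \<open>nat\<close>, \<open>Sup\<close> of a nonempty finite set is its maximum, and \<open>Sup {} = 0\<close>. The latter
  fixes the value of the maxima below when \<open>g\<close> is constant on the cube and the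
  relevant preimage is empty.
\<close>

definition sens :: "nat \<Rightarrow> ((nat \<Rightarrow> bool) \<Rightarrow> bool) \<Rightarrow> bool \<Rightarrow> nat" where
  "sens N g v = (SUP x \<in> {x \<in> cube N. g x = v}. sens_at N g x)"

definition block_sens :: "nat \<Rightarrow> ((nat \<Rightarrow> bool) \<Rightarrow> bool) \<Rightarrow> bool \<Rightarrow> nat" where
  "block_sens N g v = (SUP x \<in> {x \<in> cube N. g x = v}. block_sens_at N g x)"

abbreviation s0 where "s0 N g \<equiv> sens N g False"
abbreviation s1 where "s1 N g \<equiv> sens N g True"
abbreviation bs0 where "bs0 N g \<equiv> block_sens N g False"

end

theory Submission
  imports Defs
begin

text \<open>
  If every 0-input has at most one sensitive bit, then flipping an insensitive bit of a
  1-input does not change its set of sensitive bits. Hence the 1-inputs form disjoint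
  subcubes, and two distinct subcubes differ in at least three of their fixed bits. Let
  \<open>x\<close> be a 0-input with \<open>k\<close> disjoint minimal sensitive blocks. The flips of two of
  these blocks \<open>B\<close>, \<open>C\<close> lie in distinct subcubes, so at least three bits are in \<open>C\<close> and
  sensitive for the flip of \<open>B\<close>, or vice versa. Summing over all pairs of blocks, the
  average sensitivity of the \<open>k\<close> flips is at least \<open>3(k-1)/2\<close>.
\<close>

section \<open>Sensitive bits, attained maxima and minimal blocks\<close>

definition sens_set :: "nat \<Rightarrow> ((nat \<Rightarrow> bool) \<Rightarrow> bool) \<Rightarrow> (nat \<Rightarrow> bool) \<Rightarrow> nat set" where
  "sens_set N g x = {i \<in> {1..N}. g (flip_bits x {i}) \<noteq> g x}"

lemma finite_sens_set [simp]: "finite (sens_set N g x)"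
  by (simp add: sens_set_def)

lemma sens_at_eq: "sens_at N g x = card (sens_set N g x)"
  by (simp add: sens_at_def sens_set_def)

lemma flip_bits_empty [simp]: "flip_bits x {} = x"
  by (simp add: flip_bits_def)

lemma flip_bits_in_cube:
  assumes "x \<in> cube N" "B \<subseteq> {1..N}"
  shows "flip_bits x B \<in> cube N"
  using assms by (auto simp: cube_def flip_bits_def PiE_def extensional_def)

lemma finite_cube: "finite (cube N)"
  unfolding cube_def by (intro finite_PiE) auto

lemma sens_at_le_sens:
  assumes "x \<in> cube N" "g x = v"
  shows "sens_at N g x \<le> sens N g v"
  unfolding sens_def
  by (rule cSUP_upper) (use assms finite_cube in auto)

lemma block_sens_attained:
  assumes "block_sens N g v \<noteq> 0"
  obtains x F where "x \<in> cube N" "g x = v" "F \<subseteq> Pow {1..N}" "disjoint F"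
    "\<And>B. B \<in> F \<Longrightarrow> g (flip_bits x B) \<noteq> v" "card F = block_sens N g v"
proof -
  let ?S = "block_sens_at N g ` {x \<in> cube N. g x = v}"
  \<comment> \<open>Since \<open>Sup {} = 0\<close> on \<open>nat\<close>, a nonzero supremum rules
    out an empty preimage.\<close>
  have "?S \<noteq> {}"
    using assms unfolding block_sens_def by (metis Sup_nat_empty)
  moreover have "finite ?S"
    using finite_cube by simp
  ultimately have "Sup ?S \<in> ?S"
    by (simp add: cSup_eq_Max)
  then obtain x where x: "x \<in> cube N" "g x = v" "block_sens N g v = block_sens_at N g x"
    by (auto simp: block_sens_def)
  let ?Q = "\<lambda>F. F \<subseteq> Pow {1..N} \<and> disjoint F \<and> (\<forall>B\<in>F. g (flip_bits x B) \<noteq> g x)"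
  have "finite {card F | F. ?Q F}"
    by (rule finite_subset[of _ "card ` Pow (Pow {1..N})"]) auto
  moreover have "?Q {}"
    by (simp add: disjoint_def)
  then have "{card F | F. ?Q F} \<noteq> {}"
    by blast
  ultimately have "block_sens_at N g x \<in> {card F | F. ?Q F}"
    unfolding block_sens_at_def by (rule Max_in)
  then obtain F where "?Q F" "card F = block_sens_at N g x"
    by auto
  then show thesis
    using x by (intro that) auto
qed

text \<open>Take \<open>C\<close> inclusion-minimal among the sensitive subsets of \<open>B\<close>.
  Undoing the flip at any single bit of \<open>C\<close> restores the value \<open>g x\<close>, so
  every bit of \<open>C\<close> is sensitive for the flip of \<open>C\<close>.\<close>

lemma minimal_sensitive_block:
  assumes "g (flip_bits x B) \<noteq> g x" "B \<subseteq> {1..N}"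
  obtains C where "C \<subseteq> B" "C \<noteq> {}" "g (flip_bits x C) \<noteq> g x"
    "C \<subseteq> sens_set N g (flip_bits x C)"
proof -
  let ?S = "{C. C \<subseteq> B \<and> g (flip_bits x C) \<noteq> g x}"
  have "finite B"
    using assms(2) finite_subset by blast
  then have "finite ?S" "B \<in> ?S"
    using assms(1) by auto
  then have "\<exists>C\<in>?S. \<forall>D\<in>?S. D \<subseteq> C \<longrightarrow> C = D"
    by (intro finite_has_minimal) auto
  then obtain C where C: "C \<in> ?S" and min: "\<And>D. D \<in> ?S \<Longrightarrow> D \<subseteq> C \<Longrightarrow> C = D"
    by (elim bexE) (rule that, assumption, drule (1) bspec, drule (1) mp)
  have "i \<in> sens_set N g (flip_bits x C)" if "i \<in> C" for i
  proof -
    have "flip_bits (flip_bits x C) {i} = flip_bits x (C - {i})"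
      using that by (auto simp: flip_bits_def)
    moreover have "g (flip_bits x (C - {i})) = g x"
      using min[of "C - {i}"] C that by auto
    ultimately show ?thesis
      using C that assms(2) by (auto simp: sens_set_def)
  qed
  then show thesis
    using C by (intro that[of C]) auto
qed

section \<open>Consequences of sensitivity at most one on 0-inputs\<close>

locale zero_sens_le_one =
  fixes N :: nat and g :: "(nat \<Rightarrow> bool) \<Rightarrow> bool"
  assumes card_sens_set_zero: "\<And>x. x \<in> cube N \<Longrightarrow> \<not> g x \<Longrightarrow> card (sens_set N g x) \<le> 1"
begin

lemma zero_sens_unique:
  assumes "x \<in> cube N" "\<not> g x" "i \<in> {1..N}" "j \<in> {1..N}"
    "g (flip_bits x {i})" "g (flip_bits x {j})"
  shows "i = j"
proof -
  have "i \<in> sens_set N g x" "j \<in> sens_set N g x"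
    using assms by (auto simp: sens_set_def)
  with card_sens_set_zero[OF assms(1,2)] show ?thesis
    by (metis card_le_Suc0_iff_eq One_nat_def finite_sens_set)
qed

text \<open>Let \<open>j\<close> be sensitive for \<open>y\<close>. The 0-input obtained by flipping
  \<open>j\<close> has \<open>j\<close> as a sensitive bit, so flipping \<open>i\<close> as well
  cannot lead to a 1-input.\<close>

lemma sens_set_flip_mono:
  assumes "y \<in> cube N" "g y" "i \<in> {1..N}" "g (flip_bits y {i})"
  shows "sens_set N g y \<subseteq> sens_set N g (flip_bits y {i})"
proof
  fix j assume j: "j \<in> sens_set N g y"
  let ?w = "flip_bits y {j}"
  have jN: "j \<in> {1..N}" and w0: "\<not> g ?w" and ij: "i \<noteq> j"
    using j assms by (auto simp: sens_set_def)
  have "?w \<in> cube N"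
    using assms jN by (simp add: flip_bits_in_cube)
  moreover have "flip_bits ?w {j} = y" "flip_bits ?w {i} = flip_bits (flip_bits y {i}) {j}"
    using ij by (auto simp: flip_bits_def)
  ultimately have "\<not> g (flip_bits (flip_bits y {i}) {j})"
    using zero_sens_unique[of ?w i j] w0 assms jN ij by auto
  then show "j \<in> sens_set N g (flip_bits y {i})"
    using jN assms by (simp add: sens_set_def)
qed

text \<open>Flipping \<open>i\<close> is an involution, so the inclusion of
  \<open>sens_set_flip_mono\<close> holds in both directions.\<close>

lemma sens_set_flip:
  assumes "y \<in> cube N" "g y" "i \<in> {1..N}" "g (flip_bits y {i})"
  shows "sens_set N g (flip_bits y {i}) = sens_set N g y"
proof
  have "flip_bits (flip_bits y {i}) {i} = y"
    by (auto simp: flip_bits_def)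
  then show "sens_set N g (flip_bits y {i}) \<subseteq> sens_set N g y"
    using sens_set_flip_mono[of "flip_bits y {i}" i] assms flip_bits_in_cube[of y N "{i}"]
    by simp
qed (rule sens_set_flip_mono[OF assms])

text \<open>The bits of \<open>T\<close> are flipped one at a time. No such flip changes the set of
  sensitive bits, so the remaining bits of \<open>T\<close> stay insensitive. This yields the
  subcube around \<open>y\<close> whose fixed bits are \<open>sens_set N g y\<close>.\<close>

lemma flip_insensitive:
  assumes "y \<in> cube N" "g y" "T \<subseteq> {1..N}" "T \<inter> sens_set N g y = {}"
  shows "g (flip_bits y T) \<and> sens_set N g (flip_bits y T) = sens_set N g y"
proof -
  have "finite T"
    using assms(3) finite_subset by blast
  then show ?thesis
    using assms(3,4)
  proof (induction T)
    case empty
    then show ?case using assms by simp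
  next
    case (insert i T)
    let ?z = "flip_bits y T"
    have z: "?z \<in> cube N" "g ?z" "sens_set N g ?z = sens_set N g y"
      using insert assms by (auto simp: flip_bits_in_cube)
    have eq: "flip_bits ?z {i} = flip_bits y (insert i T)"
      using insert.hyps by (auto simp: flip_bits_def)
    have "i \<notin> sens_set N g ?z" "i \<in> {1..N}"
      using insert.prems z by auto
    then have "g (flip_bits ?z {i})"
      using z by (auto simp: sens_set_def)
    then show ?case
      using sens_set_flip[of ?z i] z \<open>i \<in> {1..N}\<close> eq by simp
  qed
qed

text \<open>Suppose \<open>D\<close> contains a sensitive bit \<open>i\<close> of \<open>u\<close>.
  If \<open>D = {i}\<close>, then flipping \<open>D\<close> gives a 0-input. If
  \<open>D = {i, j}\<close>, then the 0-input between \<open>u\<close> and the flip of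
  \<open>D\<close> has two sensitive bits, \<open>i\<close> and \<open>j\<close>.\<close>

lemma close_ones:
  assumes "u \<in> cube N" "g u" "D \<subseteq> {1..N}" "card D \<le> 2" "g (flip_bits u D)"
  shows "D \<inter> sens_set N g u = {}"
proof -
  have False if i: "i \<in> D" "i \<in> sens_set N g u" for i
  proof -
    let ?w = "flip_bits u {i}"
    have iN: "i \<in> {1..N}" and w0: "\<not> g ?w" and w: "?w \<in> cube N"
      using i assms by (auto simp: sens_set_def flip_bits_in_cube)
    have "finite D"
      using assms(3) finite_subset by blast
    then have "card (D - {i}) \<le> Suc 0"
      using i assms(4) by simp
    then consider "card (D - {i}) = 0" | "card (D - {i}) = 1"
      by linarith
    then show False
    proof cases
      case 1
      then have "D - {i} = {}" using \<open>finite D\<close> by (metis card_0_eq finite_Diff)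
      then have "D = {i}" using i by auto
      then show False using w0 assms by simp
    next
      case 2
      then obtain j where j: "D - {i} = {j}"
        by (rule card_1_singletonE)
      then have "j \<in> D - {i}" by simp
      then have "i \<noteq> j" "j \<in> {1..N}"
        using assms(3) by blast+
      moreover have "D = {i, j}"
        using j i(1) by (metis insert_Diff)
      moreover from calculation have "flip_bits ?w {j} = flip_bits u D" "flip_bits ?w {i} = u"
        by (auto simp: flip_bits_def)
      ultimately show False
        using zero_sens_unique[OF w w0 iN, of j] assms by simp
    qed
  qed
  then show ?thesis by blast
qed

text \<open>A sum of at most 2 would give points of the two subcubes at distance at most 2, and
  \<open>close_ones\<close> would force the two sets of fixed bits to agree.\<close>

lemma cross_sensitivity:
  assumes x: "x \<in> cube N" and BC: "B \<subseteq> {1..N}" "C \<subseteq> {1..N}" "B \<inter> C = {}" "B \<noteq> {}"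
    and g: "g (flip_bits x B)" "g (flip_bits x C)"
    and B: "B \<subseteq> sens_set N g (flip_bits x B)"
  shows "3 \<le> card (C \<inter> sens_set N g (flip_bits x B)) + card (B \<inter> sens_set N g (flip_bits x C))"
proof (rule ccontr)
  assume less: "\<not> ?thesis"
  let ?P = "sens_set N g (flip_bits x B)" and ?Q = "sens_set N g (flip_bits x C)"
  \<comment> \<open>\<open>u\<close> and \<open>v\<close> are the closest points of the two subcubes that contain the flips of
    \<open>B\<close> and \<open>C\<close>, and \<open>D\<close> is the set of bits in which they differ.\<close>
  define u where "u = flip_bits (flip_bits x B) (C - ?P)"
  define v where "v = flip_bits (flip_bits x C) (B - ?Q)"
  define D where "D = (C \<inter> ?P) \<union> (B \<inter> ?Q)"
  have xB: "flip_bits x B \<in> cube N" and xC: "flip_bits x C \<in> cube N"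
    using x BC by (auto intro!: flip_bits_in_cube)
  have "C - ?P \<subseteq> {1..N}" "B - ?Q \<subseteq> {1..N}"
    using BC by auto
  then have u: "u \<in> cube N" "g u" "sens_set N g u = ?P" and v: "g v" "sens_set N g v = ?Q"
    using flip_insensitive[OF xB g(1), of "C - ?P"] flip_insensitive[OF xC g(2), of "B - ?Q"]
      flip_bits_in_cube[OF xB, of "C - ?P"]
    unfolding u_def v_def by blast+
  \<comment> \<open>Relative to \<open>x\<close>, the point \<open>u\<close> is flipped on
    \<open>B\<close> and \<open>C - ?P\<close>, and \<open>v\<close> on \<open>C\<close> and
    \<open>B - ?Q\<close>. The symmetric difference of these sets is \<open>D\<close>.\<close>
  have uv: "flip_bits u D = v"
    using BC by (auto simp: u_def v_def D_def flip_bits_def fun_eq_iff)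
  have DN: "D \<subseteq> {1..N}"
    using BC by (auto simp: D_def)
  have "card D \<le> 2"
    using less card_Un_le[of "C \<inter> ?P" "B \<inter> ?Q"] by (simp add: D_def)
  then have disj: "D \<inter> ?P = {}"
    using close_ones[of u D] u v uv DN by simp
  then have "?Q = ?P"
    using flip_insensitive[of u D] u v uv DN by simp
  \<comment> \<open>Now \<open>?Q\<close> contains \<open>B\<close>, so \<open>B \<inter> ?Q\<close>
    is all of \<open>B\<close>. But \<open>B\<close> is nonempty and lies in \<open>?P\<close>, from
    which \<open>D\<close> is disjoint.\<close>
  then have "B \<subseteq> D"
    using B by (auto simp: D_def)
  then show False
    using disj B BC by auto
qed

text \<open>Double counting over ordered pairs of distinct blocks: with the blocks shrunk to minimal
  ones, \<open>a B C\<close> counts the bits of block \<open>C\<close> that are sensitive for the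
  flip of block \<open>B\<close>. Row sums are at most \<open>s1 N g\<close>, and transposed entries
  add up to at least 3.\<close>

lemma sens_one_lower_bound:
  assumes x: "x \<in> cube N" "\<not> g x"
    and F: "F \<subseteq> Pow {1..N}" "disjoint F" "\<And>B. B \<in> F \<Longrightarrow> g (flip_bits x B)"
  shows "3 * (card F * (card F - 1)) \<le> 2 * (card F * s1 N g)"
proof -
  have finF: "finite F"
    using F(1) finite_subset by blast
  have "\<forall>B\<in>F. \<exists>C. C \<subseteq> B \<and> C \<noteq> {} \<and> g (flip_bits x C) \<and> C \<subseteq> sens_set N g (flip_bits x C)"
  proof
    fix B assume "B \<in> F"
    then have "g (flip_bits x B) \<noteq> g x" "B \<subseteq> {1..N}"
      using F x by auto
    then show "\<exists>C. C \<subseteq> B \<and> C \<noteq> {} \<and> g (flip_bits x C) \<and> C \<subseteq> sens_set N g (flip_bits x C)"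
      by (rule minimal_sensitive_block) (use x in blast)
  qed
  from bchoice[OF this] obtain m where m: "\<And>B. B \<in> F \<Longrightarrow> m B \<subseteq> B" "\<And>B. B \<in> F \<Longrightarrow> m B \<noteq> {}"
    "\<And>B. B \<in> F \<Longrightarrow> g (flip_bits x (m B))"
    "\<And>B. B \<in> F \<Longrightarrow> m B \<subseteq> sens_set N g (flip_bits x (m B))"
    by blast
  have mN: "m B \<subseteq> {1..N}" if "B \<in> F" for B
    using m(1)[OF that] F(1) that by auto
  have m_disj: "m B \<inter> m C = {}" if "B \<in> F" "C \<in> F" "B \<noteq> C" for B C
    using m(1) that disjointD[OF F(2), of B C] by blast
  define A where "A B = sens_set N g (flip_bits x (m B))" for B
  define a where "a B C = card (m C \<inter> A B)" for B C
  have row: "(\<Sum>C\<in>F - {B}. a B C) \<le> s1 N g" if B: "B \<in> F" for B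
  proof -
    have "(\<Sum>C\<in>F - {B}. a B C) = card (\<Union>C\<in>F - {B}. m C \<inter> A B)"
      unfolding a_def
      by (rule card_UN_disjoint[symmetric]) (use finF m_disj in \<open>auto simp: A_def\<close>)
    also have "\<dots> \<le> card (A B)"
      by (rule card_mono) (auto simp: A_def)
    also have "\<dots> \<le> s1 N g"
      using sens_at_le_sens[of "flip_bits x (m B)" N g True] x mN[OF B] m(3)[OF B]
      by (simp add: A_def sens_at_eq flip_bits_in_cube)
    finally show ?thesis .
  qed
  have swap: "(\<Sum>B\<in>F. \<Sum>C\<in>F - {B}. a C B) = (\<Sum>B\<in>F. \<Sum>C\<in>F - {B}. a B C)"
  proof -
    \<comment> \<open>The inner index set depends on \<open>B\<close>; filling the diagonal with
      zeros makes it constant, so that \<open>sum.swap\<close> applies.\<close>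
    have off_diag: "(\<Sum>C\<in>F - {B}. f C) = (\<Sum>C\<in>F. if B = C then 0 else f C)" for f :: "_ \<Rightarrow> nat" and B
      using finF by (intro sum.mono_neutral_cong_left) auto
    show ?thesis
      unfolding off_diag by (subst sum.swap) (intro sum.cong, auto)
  qed
  have "3 * (card F * (card F - 1)) = (\<Sum>B\<in>F. \<Sum>C\<in>F - {B}. 3)"
    using finF by simp
  also have "\<dots> \<le> (\<Sum>B\<in>F. \<Sum>C\<in>F - {B}. a B C + a C B)"
  proof (intro sum_mono)
    fix B C assume "B \<in> F" "C \<in> F - {B}"
    then have B: "B \<in> F" and C: "C \<in> F" and "B \<noteq> C"
      by auto
    show "3 \<le> a B C + a C B"
      unfolding a_def A_def
      by (rule cross_sensitivity[OF x(1) mN[OF B] mN[OF C] m_disj[OF B C \<open>B \<noteq> C\<close>]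
            m(2)[OF B] m(3)[OF B] m(3)[OF C] m(4)[OF B]])
  qed
  also have "\<dots> = 2 * (\<Sum>B\<in>F. \<Sum>C\<in>F - {B}. a B C)"
    by (simp add: sum.distrib swap)
  also have "\<dots> \<le> 2 * (card F * s1 N g)"
    using sum_mono[of F "\<lambda>B. \<Sum>C\<in>F - {B}. a B C" "\<lambda>_. s1 N g"] row by simp
  finally show ?thesis .
qed

end

theorem theorem2:
  fixes N k :: nat and g :: "(nat \<Rightarrow> bool) \<Rightarrow> bool"
  assumes "s0 N g = 1"
    and "bs0 N g = k"
  shows "real (s1 N g) \<ge> 3 * (real k - 1) / 2"
proof (cases "k = 0")
  \<comment> \<open>Here \<open>k\<close> can be cancelled and the natural subtraction
    \<open>k - 1\<close> agrees with the real one. For \<open>k = 0\<close> the bound is -3/2, which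
    the final \<open>simp\<close> settles.\<close>
  case False
  interpret zero_sens_le_one N g
    using sens_at_le_sens[of _ N g False] assms(1) by unfold_locales (simp add: sens_at_eq)
  have "block_sens N g False \<noteq> 0"
    using assms(2) False by simp
  then obtain x F where "x \<in> cube N" "g x = False" "F \<subseteq> Pow {1..N}" "disjoint F"
    "\<And>B. B \<in> F \<Longrightarrow> g (flip_bits x B) \<noteq> False" "card F = bs0 N g"
    by (rule block_sens_attained) blast
  then have "3 * (k * (k - 1)) \<le> 2 * (k * s1 N g)"
    using sens_one_lower_bound[of x F] assms(2) by simp
  then have "k * (3 * (k - 1)) \<le> k * (2 * s1 N g)"
    by (simp add: algebra_simps)
  then have "3 * (k - 1) \<le> 2 * s1 N g"
    using False by simp
  then have "3 * real (k - 1) \<le> 2 * real (s1 N g)"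
    by (metis of_nat_le_iff of_nat_mult of_nat_numeral)
  then show ?thesis
    using False by simp
qed simp

end
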